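(* There exist digraphs $F_1, F_2, \dots$ such that: (i) $\vec{\chi}(F_n) \to \infty$ as $n \to \infty$; (ii) for every $n \geq 1$ and every $v \in V(F_n)$, the neighbourhood $N(v)$ of $v$ in $F_n$ can be partitioned into three sets each inducing a tournament; and (iii) for every $n \geq 1$, the in-triangle $IT$ is not a subgraph of $F_n$.
   Context: All digraphs are finite, loopless, and between any two distinct vertices at most one of the two possible arcs is present. The dichromatic number $\vec{\chi}(D)$ is the least $k$ such that $V(D)$ can be partitioned into $k$ sets each inducing an acyclic subdigraph. $N(v)$ is the set of vertices $u\neq v$ with $uv$ or $vu$ an arc. A tournament is a digraph in which every two distinct vertices are joined by exactly one arc. The in-triangle $IT$ is the digraph on vertices $a,b,c,d$ with arcs $ab, bc, ca, ad, bd, cd$. *)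

theory Defs
  imports Complex_Main "HOL-Library.Disjoint_Sets" "Graph_Theory.Graph_Theory"
begin

text \<open>
  The locale \<^locale>\<open>digraph\<close> gives finite digraphs without loops and without parallel
  arcs, but it still admits a pair of opposite arcs.
\<close>

locale oriented_digraph = digraph +
  assumes no_opposite_arcs: "u \<rightarrow>\<^bsub>G\<^esub> v \<Longrightarrow> \<not> v \<rightarrow>\<^bsub>G\<^esub> u"

definition tournament :: "('a, 'b) pre_digraph \<Rightarrow> bool" where
  "tournament G \<longleftrightarrow> oriented_digraph G \<and>
     (\<forall>u \<in> verts G. \<forall>v \<in> verts G. u \<noteq> v \<longrightarrow>
        (\<exists>!e. e \<in> arcs G \<and> arc_to_ends G e \<in> {(u, v), (v, u)}))"

definition acyclic_digraph :: "('a, 'b) pre_digraph \<Rightarrow> bool" where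
  "acyclic_digraph G \<longleftrightarrow> \<not> (\<exists>p. pre_digraph.cycle G p)"

text \<open>
  The parts of a partition may be empty, as usual when a vertex set is split into a prescribed
  number of classes; the null digraph is acyclic and a tournament.
\<close>

definition partitionable :: "nat \<Rightarrow> ('a set \<Rightarrow> bool) \<Rightarrow> 'a set \<Rightarrow> bool" where
  "partitionable k P A \<longleftrightarrow>
     (\<exists>S. (\<Union>i<k. S i) = A \<and> disjoint_family_on S {..<k} \<and> (\<forall>i<k. P (S i)))"

definition dichromatic_number :: "('a, 'b) pre_digraph \<Rightarrow> nat" where
  "dichromatic_number G =
     (LEAST k. partitionable k (\<lambda>S. acyclic_digraph (G \<restriction> S)) (verts G))"

definition neighbourhood :: "('a, 'b) pre_digraph \<Rightarrow> 'a \<Rightarrow> 'a set" where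
  "neighbourhood G v = {u \<in> verts G. u \<noteq> v \<and> (u \<rightarrow>\<^bsub>G\<^esub> v \<or> v \<rightarrow>\<^bsub>G\<^esub> u)}"

text \<open>The vertices 0, 1, 2, 3 stand for a, b, c, d.\<close>

definition in_triangle :: "nat pair_pre_digraph" where
  "in_triangle = \<lparr> pverts = {0, 1, 2, 3},
     parcs = {(0, 1), (1, 2), (2, 0), (0, 3), (1, 3), (2, 3)} \<rparr>"

text \<open>\<^const>\<open>subgraph\<close> compares concrete vertex and arc sets, so being a subgraph in the
  usual sense is taken up to isomorphism.\<close>

definition contains_digraph :: "('a, 'b) pre_digraph \<Rightarrow> ('c, 'd) pre_digraph \<Rightarrow> bool" where
  "contains_digraph G H \<longleftrightarrow> (\<exists>H'. subgraph H' G \<and> digraph_iso H H')"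

end

theory Submission
  imports Defs
begin

text \<open>
  The vertices are the points of an \<open>N \<times> N\<close> grid, and two of them are adjacent iff they
  lie on a common row, column or antidiagonal; every such line is made a transitive tournament.
  The lines through a vertex split its neighbourhood into three tournaments. A directed triangle
  must use one line of each direction, and a fourth vertex adjacent to all of its corners would
  complete a proper 3-edge-colouring of \<open>K\<^sub>4\<close> by directions, which the integer grid does not
  allow.

  The orders on the lines are induced by labels: each point gets a label below \<open>N\<close> for each
  direction. If \<open>k\<close> acyclic sets cover the grid, one of them has \<open>s \<ge> N\<^sup>2 / k\<close> points, and
  along its topological order the labels are weakly increasing on every line. For a given
  sequence of \<open>s\<close> points, the labels on it are then determined by at most \<open>12 N\<^sup>2\<close> bits
  instead of \<open>3 s log N\<close>, while the choice of the sequence accounts for only \<open>2 s log N\<close> bits.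
  So if \<open>s log N > 12 N\<^sup>2\<close>, some labelling admits no such sequence.
\<close>

section \<open>Rows, columns and antidiagonals of the grid\<close>

text \<open>
  The point \<open>p < N\<^sup>2\<close> has the coordinates \<open>p div N\<close> and \<open>p mod N\<close>; antidiagonals do not
  wrap around. The directions 0, 1, 2 stand for rows, columns and antidiagonals.
\<close>

definition line :: "nat \<Rightarrow> nat \<Rightarrow> nat \<Rightarrow> nat" where
  "line N d p = (if d = 0 then p div N else if d = 1 then p mod N else p div N + p mod N)"

text \<open>Labels may repeat; the tie break by point number keeps the order linear.\<close>

definition label_less :: "(nat \<times> nat \<Rightarrow> nat) \<Rightarrow> nat \<Rightarrow> nat \<Rightarrow> nat \<Rightarrow> bool" where
  "label_less w d p q \<longleftrightarrow> w (d, p) < w (d, q) \<or> w (d, p) = w (d, q) \<and> p < q"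

definition grid_digraph :: "nat \<Rightarrow> (nat \<times> nat \<Rightarrow> nat) \<Rightarrow> nat pair_pre_digraph" where
  "grid_digraph N w = \<lparr> pverts = {..<N\<^sup>2},
     parcs = {(p, q). p < N\<^sup>2 \<and> q < N\<^sup>2 \<and>
       (\<exists>d<3. line N d p = line N d q \<and> label_less w d p q)} \<rparr>"

lemma less_3_cases: "d < 3 \<longleftrightarrow> d = 0 \<or> d = 1 \<or> d = (2::nat)"
  by auto

lemma two_lines_eq:
  assumes "line N d p = line N d q" "line N e p = line N e q" "d < 3" "e < 3" "d \<noteq> e"
  shows "p = q"
proof -
  have "p div N = q div N" "p mod N = q mod N"
    using assms by (auto simp: line_def less_3_cases)
  then show ?thesis by (metis div_mult_mod_eq)
qed

lemma line_less:
  assumes "p < N\<^sup>2"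
  shows "line N d p < 2 * N" and "d < 2 \<Longrightarrow> line N d p < N"
proof -
  have "N > 0" using assms by (cases N) auto
  then have "p mod N < N" by simp
  moreover have "p div N < N"
    using assms by (simp add: power2_eq_square less_mult_imp_div_less)
  moreover have "line N d p \<le> p div N + p mod N" by (simp add: line_def)
  moreover have "line N d p = p div N \<or> line N d p = p mod N" if "d < 2"
    using that by (auto simp: line_def)
  ultimately show "line N d p < 2 * N" "d < 2 \<Longrightarrow> line N d p < N"
    by linarith+
qed

text \<open>Points of a line differ in their row or in their column, whichever is another direction,
  and there are only \<open>N\<close> of those.\<close>

lemma card_on_line_le:
  assumes "d < 3" "A \<subseteq> {..<N\<^sup>2}" "\<And>p. p \<in> A \<Longrightarrow> line N d p = l"
  shows "card A \<le> N"
proof -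
  obtain e :: nat where e: "e < 2" "e \<noteq> d" by (metis one_less_numeral_iff pos2 semiring_norm(76) zero_neq_one)
  have "inj_on (line N e) A"
    by (rule inj_onI, rule two_lines_eq[of N d _ _ e]) (use assms e in auto)
  moreover have "line N e ` A \<subseteq> {..<N}"
    using assms(2) e by (auto intro!: line_less)
  ultimately show ?thesis
    using card_inj_on_le[of "line N e" A "{..<N}"] by auto
qed

text \<open>Rows and columns make the four points the corners of a rectangle; the antidiagonal
  condition on both pairs of opposite corners then gives twice each side length zero. Modulo an even
  \<open>N\<close> this would not suffice, so antidiagonals must not wrap around.\<close>

lemma no_rainbow_K4:
  assumes "p \<noteq> q"
    and "line N d1 p = line N d1 q" "line N d1 r = line N d1 t"
    and "line N d2 q = line N d2 r" "line N d2 p = line N d2 t"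
    and "line N d3 r = line N d3 p" "line N d3 q = line N d3 t"
    and "d1 < 3" "d2 < 3" "d3 < 3" "d1 \<noteq> d2" "d2 \<noteq> d3" "d1 \<noteq> d3"
  shows False
proof -
  have "p div N = q div N \<and> p mod N = q mod N"
    using assms(2-) by (auto simp: line_def less_3_cases)
  then show False using assms(1) by (metis div_mult_mod_eq)
qed

section \<open>Labels and the orientation of arcs\<close>

lemma label_less_trans: "label_less w d p q \<Longrightarrow> label_less w d q r \<Longrightarrow> label_less w d p r"
  by (auto simp: label_less_def)

lemma label_less_irrefl: "\<not> label_less w d p p"
  by (auto simp: label_less_def)

lemma label_less_linear: "p \<noteq> q \<Longrightarrow> label_less w d p q \<or> label_less w d q p"
  by (auto simp: label_less_def)

lemma parcs_grid_digraphE: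
  assumes "(p, q) \<in> parcs (grid_digraph N w)"
  obtains d where "d < 3" "line N d p = line N d q" "label_less w d p q" "p \<noteq> q"
  using assms label_less_irrefl by (fastforce simp: grid_digraph_def)

text \<open>Distinct points share only one line, so the direction witnessing the arc is
  \<open>d\<close>.\<close>

lemma parcs_grid_digraph_same_line:
  assumes "(p, q) \<in> parcs (grid_digraph N w)" "d < 3" "line N d p = line N d q"
  shows "label_less w d p q"
  using assms by (metis parcs_grid_digraphE two_lines_eq)

lemma collinear_adjacent:
  assumes "p < N\<^sup>2" "q < N\<^sup>2" "p \<noteq> q" "d < 3" "line N d p = line N d q"
  shows "(p, q) \<in> parcs (grid_digraph N w) \<or> (q, p) \<in> parcs (grid_digraph N w)"
proof -
  consider "label_less w d p q" | "label_less w d q p"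
    using label_less_linear[OF assms(3)] by blast
  then show ?thesis
    by cases (use assms in \<open>auto simp: grid_digraph_def\<close>)
qed

lemma grid_digraph_antisym:
  assumes "(p, q) \<in> parcs (grid_digraph N w)"
  shows "(q, p) \<notin> parcs (grid_digraph N w)"
  using assms by (metis parcs_grid_digraphE parcs_grid_digraph_same_line label_less_trans label_less_irrefl)

lemma oriented_digraph_grid_restrict:
  assumes "S \<subseteq> {..<N\<^sup>2}"
  shows "oriented_digraph (with_proj (grid_digraph N w) \<restriction> S)"
proof
  let ?G = "with_proj (grid_digraph N w) \<restriction> S"
  have fin: "finite S" using assms finite_subset by blast
  show "finite (verts ?G)" using fin by simp
  have "arcs ?G \<subseteq> S \<times> S" by auto
  then show "finite (arcs ?G)" using fin finite_subset by blast
  show "tail ?G e \<in> verts ?G" if "e \<in> arcs ?G" for e using that by auto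
  show "head ?G e \<in> verts ?G" if "e \<in> arcs ?G" for e using that by auto
  show "tail ?G e \<noteq> head ?G e" if "e \<in> arcs ?G" for e
    using that grid_digraph_antisym[of "fst e" "snd e" N w] by (cases e) auto
  show "e1 = e2" if "e1 \<in> arcs ?G" "e2 \<in> arcs ?G" "arc_to_ends ?G e1 = arc_to_ends ?G e2" for e1 e2
    using that by (auto simp: arc_to_ends_def)
  show "\<not> v \<rightarrow>\<^bsub>?G\<^esub> u" if "u \<rightarrow>\<^bsub>?G\<^esub> v" for u v
    using that grid_digraph_antisym[of u v N w] by (auto simp: arcs_ends_conv)
qed

lemma oriented_digraph_grid: "oriented_digraph (with_proj (grid_digraph N w))"
proof -
  have "with_proj (grid_digraph N w) \<restriction> {..<N\<^sup>2} = with_proj (grid_digraph N w)"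
    by (auto simp: induce_subgraph_def with_proj_def grid_digraph_def)
  then show ?thesis
    using oriented_digraph_grid_restrict[of "{..<N\<^sup>2}" N w] by simp
qed

section \<open>Neighbourhoods\<close>

lemma tournament_collinear:
  assumes "S \<subseteq> {..<N\<^sup>2}" "d < 3" "\<And>p. p \<in> S \<Longrightarrow> line N d p = l"
  shows "tournament (with_proj (grid_digraph N w) \<restriction> S)"
  unfolding tournament_def
proof (intro conjI ballI impI)
  let ?G = "with_proj (grid_digraph N w) \<restriction> S"
  show "oriented_digraph ?G"
    using assms(1) by (rule oriented_digraph_grid_restrict)
  fix u v assume uv: "u \<in> verts ?G" "v \<in> verts ?G" "u \<noteq> v"
  then have "(u, v) \<in> parcs (grid_digraph N w) \<or> (v, u) \<in> parcs (grid_digraph N w)"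
    using assms by (intro collinear_adjacent[of _ _ _ d]) auto
  with uv show "\<exists>!e. e \<in> arcs ?G \<and> arc_to_ends ?G e \<in> {(u, v), (v, u)}"
    using grid_digraph_antisym[of u v N w] by (auto simp: arc_to_ends_def)
qed

lemma neighbourhood_grid:
  assumes "v < N\<^sup>2"
  shows "neighbourhood (with_proj (grid_digraph N w)) v =
    (\<Union>d<3. {u. u < N\<^sup>2 \<and> u \<noteq> v \<and> line N d u = line N d v})" (is "?L = ?R")
proof
  show "?L \<subseteq> ?R"
  proof
    fix u assume "u \<in> ?L"
    then have u: "u < N\<^sup>2" "u \<noteq> v" and
      "(u, v) \<in> parcs (grid_digraph N w) \<or> (v, u) \<in> parcs (grid_digraph N w)"
      by (auto simp: neighbourhood_def, auto simp: grid_digraph_def)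
    then obtain d where "d < 3" "line N d u = line N d v"
      by (metis parcs_grid_digraphE)
    with u show "u \<in> ?R" by auto
  qed
  show "?R \<subseteq> ?L"
    using collinear_adjacent[OF _ assms] by (auto simp: neighbourhood_def grid_digraph_def)
qed

lemma partitionable_neighbourhood_grid:
  assumes "v < N\<^sup>2"
  shows "partitionable 3 (\<lambda>S. tournament (with_proj (grid_digraph N w) \<restriction> S))
    (neighbourhood (with_proj (grid_digraph N w)) v)"
  unfolding partitionable_def neighbourhood_grid[OF assms]
proof (intro exI conjI allI impI)
  show "disjoint_family_on (\<lambda>d. {u. u < N\<^sup>2 \<and> u \<noteq> v \<and> line N d u = line N d v}) {..<3}"
    using two_lines_eq unfolding disjoint_family_on_def by blast
  show "tournament (with_proj (grid_digraph N w) \<restriction> {u. u < N\<^sup>2 \<and> u \<noteq> v \<and> line N d u = line N d v})"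
    if "d < 3" for d
    by (rule tournament_collinear[of _ _ d "line N d v"]) (use that in auto)
qed simp

section \<open>Exclusion of the in-triangle\<close>

lemma no_in_triangle_arcs:
  assumes ab: "(a, b) \<in> parcs (grid_digraph N w)" and bc: "(b, c) \<in> parcs (grid_digraph N w)"
    and ca: "(c, a) \<in> parcs (grid_digraph N w)" and ad: "(a, x) \<in> parcs (grid_digraph N w)"
    and bd: "(b, x) \<in> parcs (grid_digraph N w)" and cd: "(c, x) \<in> parcs (grid_digraph N w)"
  shows False
proof -
  obtain i where i: "i < 3" "line N i a = line N i b" "a \<noteq> b" using ab parcs_grid_digraphE by metis
  obtain j where j: "j < 3" "line N j b = line N j c" "b \<noteq> c" using bc parcs_grid_digraphE by metis
  obtain k where k: "k < 3" "line N k c = line N k a" "c \<noteq> a" using ca parcs_grid_digraphE by metis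
  \<comment> \<open>\<open>label_less\<close> is transitive, so no line contains a cyclic triangle;
    hence its sides have three different directions.\<close>
  have *: False if "l < 3" "line N l a = line N l b" "line N l b = line N l c" for l
    using that parcs_grid_digraph_same_line[OF ab, of l] parcs_grid_digraph_same_line[OF bc, of l]
      parcs_grid_digraph_same_line[OF ca, of l] label_less_trans label_less_irrefl by metis
  have ne: "i \<noteq> j" "j \<noteq> k" "i \<noteq> k"
    using i j k * by metis+
  have cover: "l = i \<or> l = j \<or> l = k" if "l < 3" for l
    using that i j k ne unfolding less_3_cases by presburger
  obtain i' where i': "i' < 3" "line N i' a = line N i' x" "a \<noteq> x" using ad parcs_grid_digraphE by metis
  obtain j' where j': "j' < 3" "line N j' b = line N j' x" "b \<noteq> x" using bd parcs_grid_digraphE by metis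
  obtain k' where k': "k' < 3" "line N k' c = line N k' x" "c \<noteq> x" using cd parcs_grid_digraphE by metis
  \<comment> \<open>Were \<open>x\<close> on the line through \<open>a\<close> and \<open>b\<close>,
    the edge from \<open>c\<close> to \<open>x\<close> would, depending on its direction, put
    \<open>c\<close> on that line or make \<open>x\<close> share two lines with \<open>b\<close> or
    with \<open>a\<close>. The other sides are alike.\<close>
  have off_i: "line N i x \<noteq> line N i a"
    using cover[OF k'(1)] i j k i' j' k' ne * two_lines_eq by metis
  have off_j: "line N j x \<noteq> line N j b"
    using cover[OF i'(1)] i j k i' j' k' ne * two_lines_eq by metis
  have off_k: "line N k x \<noteq> line N k c"
    using cover[OF j'(1)] i j k i' j' k' ne * two_lines_eq by metis
  \<comment> \<open>The edge from \<open>a\<close> to \<open>x\<close> has the direction of neither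
    side at \<open>a\<close>, so it has that of the opposite side; likewise for \<open>b\<close> and
    \<open>c\<close>.\<close>
  have "i' = j" "j' = k" "k' = i"
    using cover[OF i'(1)] cover[OF j'(1)] cover[OF k'(1)] off_i off_j off_k i i' j j' k k' by metis+
  then show False
    using no_rainbow_K4[of a b N i c x j k] i j k i' j' k' ne by metis
qed

lemma grid_digraph_no_in_triangle:
  "\<not> contains_digraph (with_proj (grid_digraph N w)) (with_proj in_triangle)"
proof
  let ?G = "with_proj (grid_digraph N w)"
  assume "contains_digraph ?G (with_proj in_triangle)"
  then obtain f where f: "pre_digraph.digraph_isomorphism (with_proj in_triangle) f"
    and sub: "subgraph (app_iso f (with_proj in_triangle)) ?G"
    by (auto simp: contains_digraph_def digraph_iso_def)
  have arc: "(iso_verts f u, iso_verts f v) \<in> parcs (grid_digraph N w)"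
    if "(u, v) \<in> parcs in_triangle" for u v
  proof -
    have "iso_arcs f (u, v) \<in> parcs (grid_digraph N w)" "iso_tail f = fst" "iso_head f = snd"
      using sub that by (auto simp: subgraph_def app_iso_def compatible_def)
    moreover have "iso_verts f u = iso_tail f (iso_arcs f (u, v))"
      "iso_verts f v = iso_head f (iso_arcs f (u, v))"
      using f that by (auto simp: pre_digraph.digraph_isomorphism_def)
    ultimately show ?thesis by simp
  qed
  show False
    by (rule no_in_triangle_arcs[of "iso_verts f 0" "iso_verts f 1" N w "iso_verts f 2" "iso_verts f 3"];
        rule arc; simp add: in_triangle_def)
qed

section \<open>Topological orders\<close>

text \<open>On the finite set \<open>A\<close> the relation is well founded, so some element has no
  predecessor in \<open>A\<close>; it goes first and induction lists the rest.\<close>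

lemma topological_list:
  assumes "finite A" "acyclic r"
  shows "\<exists>L. set L = A \<and> distinct L \<and>
    (\<forall>i j. i < j \<longrightarrow> j < length L \<longrightarrow> (L ! j, L ! i) \<notin> r)"
  using assms(1)
proof (induction A rule: finite_psubset_induct)
  case (psubset A)
  show ?case
  proof (cases "A = {}")
    case False
    have "finite (r \<inter> A \<times> A)" using psubset by simp
    moreover have "acyclic (r \<inter> A \<times> A)" using assms(2) by (meson acyclic_subset inf_le1)
    ultimately have "wf (r \<inter> A \<times> A)" by (rule finite_acyclic_wf)
    then obtain m where m: "m \<in> A" "\<And>y. (y, m) \<in> r \<Longrightarrow> y \<notin> A"
      using False unfolding wf_eq_minimal by (metis (no_types, lifting) IntI SigmaI ex_in_conv)
    obtain L where L: "set L = A - {m}" "distinct L"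
      "\<forall>i j. i < j \<longrightarrow> j < length L \<longrightarrow> (L ! j, L ! i) \<notin> r"
      using psubset.IH[of "A - {m}"] m(1) by blast
    have "((m # L) ! j, (m # L) ! i) \<notin> r" if "i < j" "j < length (m # L)" for i j
    proof -
      obtain j' where j: "j = Suc j'" using \<open>i < j\<close> less_imp_Suc_add by blast
      have "L ! j' \<in> A" using L(1) that j nth_mem[of j' L] by auto
      then show ?thesis using m(2) L(3) that j by (cases i) auto
    qed
    moreover have "set (m # L) = A" "distinct (m # L)" using L m(1) by auto
    ultimately show ?thesis by blast
  qed simp
qed

text \<open>A nonempty closed walk contains a cycle.\<close>

lemma acyclic_arcs_ends:
  assumes "wf_digraph G" "acyclic_digraph G"
  shows "acyclic (arcs_ends G)"
proof (rule acyclicI, intro allI notI)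
  fix v assume "v \<rightarrow>\<^sup>+\<^bsub>G\<^esub> v"
  then obtain p where "pre_digraph.awalk G v p v" "p \<noteq> []"
    using wf_digraph.reachable1_awalk[OF assms(1)] by blast
  then have "wf_digraph.closed_w G p" using assms(1) by (auto simp: wf_digraph.closed_w_def)
  then show False
    using wf_digraph.closed_w_imp_cycle[OF assms(1)] assms(2) by (auto simp: acyclic_digraph_def)
qed

section \<open>Counting the labellings monotone along a list\<close>

text \<open>Listing \<open>I\<close> increasingly, both functions yield the sorted list of the same
  set.\<close>

lemma strict_mono_on_image_unique:
  fixes f g :: "nat \<Rightarrow> nat"
  assumes "finite I" "strict_mono_on I f" "strict_mono_on I g" "f ` I = g ` I" "i \<in> I"
  shows "f i = g i"
proof -
  let ?xs = "sorted_list_of_set I"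
  have *: "sorted (map h ?xs)" "distinct (map h ?xs)" if "strict_mono_on I h" for h :: "nat \<Rightarrow> nat"
  proof -
    have "mono_on I h" using that by (simp add: strict_mono_on_imp_mono_on)
    then show "sorted (map h ?xs)"
      using assms(1) by (intro sorted_map_mono) auto
    show "distinct (map h ?xs)"
      using that assms(1) by (auto simp: distinct_map strict_mono_on_imp_inj_on)
  qed
  have "map f ?xs = map g ?xs"
    by (rule sorted_distinct_set_unique) (use * assms in auto)
  then show ?thesis using assms(1,5) by (auto simp: map_eq_conv)
qed

text \<open>A necessary condition for \<open>L\<close> to order an acyclic set topologically.
  Extensionality makes the set finite.\<close>

definition monotone_labels :: "nat \<Rightarrow> nat list \<Rightarrow> (nat \<times> nat \<Rightarrow> nat) set" where
  "monotone_labels N L = {w \<in> {..<3} \<times> {..<N\<^sup>2} \<rightarrow>\<^sub>E {..<N}.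
     \<forall>d i j. d < 3 \<longrightarrow> i < j \<longrightarrow> j < length L \<longrightarrow> line N d (L ! i) = line N d (L ! j) \<longrightarrow>
       w (d, L ! i) \<le> w (d, L ! j)}"

text \<open>
  Adding the rank turns the weakly increasing labels along a line into strictly increasing
  numbers, which are recovered from their set.
\<close>

definition line_rank :: "nat \<Rightarrow> nat list \<Rightarrow> nat \<Rightarrow> nat \<Rightarrow> nat" where
  "line_rank N L d i = card {j. j < i \<and> line N d (L ! j) = line N d (L ! i)}"

text \<open>The position \<open>i\<close> is forgotten, so that a code is just a subset of a box and
  costs one bit per triple of the box.\<close>

definition label_code :: "nat \<Rightarrow> nat list \<Rightarrow> (nat \<times> nat \<Rightarrow> nat) \<Rightarrow> (nat \<times> nat \<times> nat) set" where
  "label_code N L w =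
     {(d, line N d (L ! i), w (d, L ! i) + line_rank N L d i) | d i. d < 3 \<and> i < length L}"

lemma line_rank_less:
  assumes "set L \<subseteq> {..<N\<^sup>2}" "distinct L" "i < length L" "d < 3"
  shows "line_rank N L d i < N"
proof -
  \<comment> \<open>\<open>?J\<close> counts \<open>i\<close> itself too, which makes the bound on
    the rank strict.\<close>
  let ?J = "{j. j \<le> i \<and> line N d (L ! j) = line N d (L ! i)}"
  have "inj_on ((!) L) ?J"
    using assms by (intro inj_onI) (auto simp: nth_eq_iff_index_eq)
  then have "card ?J = card ((!) L ` ?J)" by (simp add: card_image)
  also have "\<dots> \<le> N"
  proof (rule card_on_line_le[OF assms(4)])
    show "(!) L ` ?J \<subseteq> {..<N\<^sup>2}"
    proof
      fix p assume "p \<in> (!) L ` ?J"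
      then obtain j where "j \<le> i" "p = L ! j" by blast
      then have "j < length L" "p = L ! j" using assms(3) by auto
      then show "p \<in> {..<N\<^sup>2}" using assms(1) nth_mem by blast
    qed
  qed auto
  finally have "card ?J \<le> N" .
  moreover have "line_rank N L d i < card ?J"
    unfolding line_rank_def by (rule psubset_card_mono) auto
  ultimately show ?thesis by simp
qed

lemma line_rank_strict_mono:
  assumes "i < j" "line N d (L ! i) = line N d (L ! j)"
  shows "line_rank N L d i < line_rank N L d j"
  unfolding line_rank_def by (rule psubset_card_mono) (use assms in auto)

text \<open>The triples for one line carry the image of a strictly increasing function on the
  positions of that line in \<open>L\<close>, and these positions do not depend on the
  labelling.\<close>

lemma label_code_unique:
  assumes "w \<in> monotone_labels N L" "w' \<in> monotone_labels N L"
    and "label_code N L w = label_code N L w'" "d < 3" "i < length L"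
  shows "w (d, L ! i) = w' (d, L ! i)"
proof -
  define l where "l = line N d (L ! i)"
  define I where "I = {j. j < length L \<and> line N d (L ! j) = l}"
  define h where "h v j = v (d, L ! j) + line_rank N L d j" for v :: "nat \<times> nat \<Rightarrow> nat" and j
  have mono: "strict_mono_on I (h v)" if "v \<in> monotone_labels N L" for v
  proof (rule strict_mono_onI)
    fix j j' assume "j \<in> I" "j' \<in> I" "j < j'"
    then show "h v j < h v j'"
      using that \<open>d < 3\<close> line_rank_strict_mono[of j j' N d L]
      by (auto simp: monotone_labels_def I_def h_def intro!: add_le_less_mono)
  qed
  have img: "h v ` I = {z. (d, l, z) \<in> label_code N L v}" for v
    using \<open>d < 3\<close> by (auto simp: label_code_def I_def h_def)
  have "h w i = h w' i"
    by (rule strict_mono_on_image_unique[of I])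
      (use assms mono img in \<open>auto simp: I_def l_def\<close>)
  then show ?thesis by (simp add: h_def)
qed

text \<open>The code determines the labels on \<open>L\<close>; the remaining labels are free and
  recorded as they are.\<close>

lemma card_monotone_labels_le:
  assumes "set L \<subseteq> {..<N\<^sup>2}" "distinct L"
  shows "card (monotone_labels N L) \<le> 2 ^ (12 * N\<^sup>2) * N ^ (3 * (N\<^sup>2 - length L))"
proof -
  let ?D = "{..<3::nat} \<times> ({..<N\<^sup>2} - set L)"
  \<comment> \<open>Line numbers are below \<open>2 * N\<close>, and so is a label plus a rank, both
    below \<open>N\<close>. The box has \<open>12 * N\<^sup>2\<close> triples.\<close>
  let ?B = "{..<3::nat} \<times> {..<2 * N} \<times> {..<2 * N}"
  let ?f = "\<lambda>w. (label_code N L w, restrict w ?D)"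
  have "inj_on ?f (monotone_labels N L)"
  proof (rule inj_onI)
    fix w w' assume w: "w \<in> monotone_labels N L" and w': "w' \<in> monotone_labels N L" and eq: "?f w = ?f w'"
    have code: "label_code N L w = label_code N L w'" and res: "restrict w ?D = restrict w' ?D"
      using eq by auto
    have PE: "w \<in> {..<3} \<times> {..<N\<^sup>2} \<rightarrow>\<^sub>E {..<N}" "w' \<in> {..<3} \<times> {..<N\<^sup>2} \<rightarrow>\<^sub>E {..<N}"
      using w w' by (auto simp: monotone_labels_def)
    show "w = w'"
    proof (rule PiE_ext[OF PE])
      fix x assume x: "x \<in> {..<3::nat} \<times> {..<N\<^sup>2}"
      show "w x = w' x"
      proof (cases "snd x \<in> set L")
        case True
        then obtain i where "i < length L" "snd x = L ! i" by (auto simp: in_set_conv_nth)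
        then show ?thesis
          using label_code_unique[OF w w' code, of "fst x" i] x by (cases x) auto
      next
        case False
        then have "x \<in> ?D" using x by auto
        then show ?thesis using fun_cong[OF res, of x] by simp
      qed
    qed
  qed
  moreover have "?f ` monotone_labels N L \<subseteq> Pow ?B \<times> (?D \<rightarrow>\<^sub>E {..<N})"
  proof (intro image_subsetI SigmaI)
    fix w assume "w \<in> monotone_labels N L"
    then have w: "w \<in> {..<3} \<times> {..<N\<^sup>2} \<rightarrow>\<^sub>E {..<N}" by (simp add: monotone_labels_def)
    show "restrict w ?D \<in> ?D \<rightarrow>\<^sub>E {..<N}"
      using w by (auto simp: PiE_iff)
    show "label_code N L w \<in> Pow ?B"
    proof (clarsimp simp: label_code_def)
      fix d i assume d: "d < (3::nat)" and i: "i < length L"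
      then have Li: "L ! i < N\<^sup>2" using assms(1) nth_mem by blast
      then have "w (d, L ! i) < N" using w d by (auto simp: PiE_iff)
      with line_rank_less[OF assms i d] line_less(1)[OF Li]
      show "line N d (L ! i) < 2 * N \<and> w (d, L ! i) + line_rank N L d i < 2 * N"
        by simp
    qed
  qed
  ultimately have "card (monotone_labels N L) \<le> card (Pow ?B \<times> (?D \<rightarrow>\<^sub>E {..<N}))"
    by (rule card_inj_on_le) (auto intro!: finite_PiE)
  also have "\<dots> = 2 ^ (12 * N\<^sup>2) * N ^ (3 * (N\<^sup>2 - length L))"
    using assms by (simp add: card_cartesian_product card_Pow card_PiE card_Diff_subset
        distinct_card power2_eq_square)
  finally show ?thesis .
qed

section \<open>Labellings without large acyclic sets\<close>

text \<open>In a topological order the arc between two points of a line goes forward, so labels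
  cannot drop. Cutting the list to its first \<open>s\<close> points keeps this and gives all
  labellings lists of one length.\<close>

lemma acyclic_imp_monotone_labels:
  assumes w: "w \<in> {..<3} \<times> {..<N\<^sup>2} \<rightarrow>\<^sub>E {..<N}"
    and S: "S \<subseteq> {..<N\<^sup>2}" "s \<le> card S"
    and ac: "acyclic_digraph (with_proj (grid_digraph N w) \<restriction> S)"
  obtains L where "set L \<subseteq> {..<N\<^sup>2}" "distinct L" "length L = s" "w \<in> monotone_labels N L"
proof -
  let ?G = "with_proj (grid_digraph N w) \<restriction> S"
  interpret oriented_digraph ?G by (rule oriented_digraph_grid_restrict[OF S(1)])
  have "finite S" using S(1) finite_subset by blast
  then obtain L where L: "set L = S" "distinct L"
    "\<And>i j. i < j \<Longrightarrow> j < length L \<Longrightarrow> (L ! j, L ! i) \<notin> arcs_ends ?G"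
    using topological_list acyclic_arcs_ends[OF wf_digraph ac] by metis
  have len: "s \<le> length L" using S(2) L distinct_card by metis
  have le: "w (d, L ! i) \<le> w (d, L ! j)"
    if "d < 3" "i < j" "j < length L" "line N d (L ! i) = line N d (L ! j)" for d i j
  proof -
    have mem: "L ! i \<in> S" "L ! j \<in> S" using L(1) that by auto
    have "L ! i \<noteq> L ! j" using L(2) that by (simp add: nth_eq_iff_index_eq)
    then have "(L ! i, L ! j) \<in> parcs (grid_digraph N w) \<or> (L ! j, L ! i) \<in> parcs (grid_digraph N w)"
      using mem S(1) that by (intro collinear_adjacent[of _ _ _ d]) auto
    moreover have "(L ! j, L ! i) \<notin> parcs (grid_digraph N w)"
      using L(3)[OF that(2,3)] mem by (force simp: arcs_ends_conv)
    ultimately have "label_less w d (L ! i) (L ! j)"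
      using parcs_grid_digraph_same_line that by blast
    then show ?thesis by (auto simp: label_less_def)
  qed
  show thesis
  proof (rule that[of "take s L"])
    show "set (take s L) \<subseteq> {..<N\<^sup>2}" using L(1) S(1) set_take_subset by fastforce
    show "w \<in> monotone_labels N (take s L)"
      using w le by (auto simp: monotone_labels_def)
  qed (use L(2) len in auto)
qed

text \<open>Otherwise every labelling is monotone along one of at most \<open>N ^ (2 * s)\<close>
  lists. Counting gives \<open>N ^ s \<le> 2 ^ (12 * N\<^sup>2)\<close>, and
  \<open>N\<^sup>2 \<le> k * s\<close> turns this into \<open>N \<le> 2 ^ (12 * k)\<close>, which
  the extra factor 2 in \<open>N\<close> rules out.\<close>

lemma exists_labels_no_large_acyclic:
  assumes N: "N = 2 ^ (12 * k + 1)"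
  shows "\<exists>w. \<forall>S \<subseteq> {..<N\<^sup>2}. acyclic_digraph (with_proj (grid_digraph N w) \<restriction> S) \<longrightarrow> k * card S < N\<^sup>2"
proof (rule ccontr)
  assume contra: "\<not> ?thesis"
  let ?W = "{..<3::nat} \<times> {..<N\<^sup>2} \<rightarrow>\<^sub>E {..<N}"
  have N0: "N > 0" using N by simp
  \<comment> \<open>The negated claim supplies a candidate, so the least value exists; it does not
    depend on the labelling.\<close>
  define s where "s = (LEAST s. N\<^sup>2 \<le> k * s)"
  have ex: "\<exists>S \<subseteq> {..<N\<^sup>2}. acyclic_digraph (with_proj (grid_digraph N w) \<restriction> S) \<and> N\<^sup>2 \<le> k * card S" for w
    using contra by (metis not_less)
  have s_ge: "N\<^sup>2 \<le> k * s"
    unfolding s_def using ex by (metis (mono_tags, lifting) LeastI)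
  then have "s > 0" using N0 by (cases s) auto
  have s_le: "s \<le> card S" if "N\<^sup>2 \<le> k * card S" for S :: "nat set"
    unfolding s_def using that by (rule Least_le)
  obtain S0 where "S0 \<subseteq> {..<N\<^sup>2}" "N\<^sup>2 \<le> k * card S0" using ex by blast
  then have sN: "s \<le> N\<^sup>2" using s_le[of S0] card_mono[of "{..<N\<^sup>2}" S0] by auto
  define Ls where "Ls = {L. set L \<subseteq> {..<N\<^sup>2} \<and> length L = s \<and> distinct L}"
  have fin: "finite {L. set L \<subseteq> {..<N\<^sup>2} \<and> length L = s}" by (simp add: finite_lists_length_eq)
  have finLs: "finite Ls" unfolding Ls_def by (rule finite_subset[OF _ fin]) auto
  have "card Ls \<le> card {L. set L \<subseteq> {..<N\<^sup>2} \<and> length L = s}"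
    unfolding Ls_def by (rule card_mono[OF fin]) auto
  then have card_Ls: "card Ls \<le> N ^ (2 * s)"
    by (simp add: card_lists_length_eq power_mult)
  have "?W \<subseteq> (\<Union>L\<in>Ls. monotone_labels N L)"
  proof
    fix w assume w: "w \<in> ?W"
    obtain S where S: "S \<subseteq> {..<N\<^sup>2}" "acyclic_digraph (with_proj (grid_digraph N w) \<restriction> S)" "s \<le> card S"
      using ex s_le by blast
    obtain L where "set L \<subseteq> {..<N\<^sup>2}" "distinct L" "length L = s" "w \<in> monotone_labels N L"
      using acyclic_imp_monotone_labels[OF w S(1,3,2)] by blast
    then show "w \<in> (\<Union>L\<in>Ls. monotone_labels N L)" unfolding Ls_def by blast
  qed
  moreover have "finite (monotone_labels N L)" for L
    unfolding monotone_labels_def by (intro finite_subset[OF _ finite_PiE[of "{..<3} \<times> {..<N\<^sup>2}" "\<lambda>_. {..<N}"]]) auto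
  ultimately have "card ?W \<le> card (\<Union>L\<in>Ls. monotone_labels N L)"
    using finLs by (intro card_mono) auto
  also have "\<dots> \<le> (\<Sum>L\<in>Ls. card (monotone_labels N L))"
    by (rule card_UN_le[OF finLs])
  also have "\<dots> \<le> (\<Sum>L\<in>Ls. 2 ^ (12 * N\<^sup>2) * N ^ (3 * (N\<^sup>2 - s)))"
    by (rule sum_mono) (use card_monotone_labels_le in \<open>auto simp: Ls_def\<close>)
  also have "\<dots> \<le> N ^ (2 * s) * (2 ^ (12 * N\<^sup>2) * N ^ (3 * (N\<^sup>2 - s)))"
    using card_Ls by (simp add: mult_right_mono)
  also have "card ?W = N ^ (3 * N\<^sup>2)" by (simp add: card_PiE card_cartesian_product)
  \<comment> \<open>\<open>s \<le> N\<^sup>2\<close> makes the truncated difference exact.\<close>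
  also have "N ^ (3 * N\<^sup>2) = N ^ s * N ^ (2 * s + 3 * (N\<^sup>2 - s))"
    unfolding power_add[symmetric] by (rule arg_cong[of _ _ "power N"]) (use sN in simp)
  also have "N ^ (2 * s) * (2 ^ (12 * N\<^sup>2) * N ^ (3 * (N\<^sup>2 - s))) =
      2 ^ (12 * N\<^sup>2) * N ^ (2 * s + 3 * (N\<^sup>2 - s))"
    by (simp only: power_add mult_ac)
  finally have "N ^ s * N ^ (2 * s + 3 * (N\<^sup>2 - s)) \<le> 2 ^ (12 * N\<^sup>2) * N ^ (2 * s + 3 * (N\<^sup>2 - s))" .
  then have "N ^ s \<le> 2 ^ (12 * N\<^sup>2)" using N0 by (metis mult_le_cancel2 zero_less_power)
  also have "\<dots> \<le> 2 ^ (12 * (k * s))" using s_ge by (intro power_increasing) auto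
  also have "\<dots> = (2 ^ (12 * k)) ^ s" by (simp add: power_mult mult.assoc)
  finally have "N \<le> 2 ^ (12 * k)" using \<open>s > 0\<close> by (simp add: power_mono_iff)
  then show False using N by simp
qed

section \<open>Bounding the dichromatic number from below\<close>

text \<open>Ensures that the \<open>LEAST\<close> in \<open>dichromatic_number\<close> is attained:
  without loops, single vertices are acyclic classes.\<close>

lemma partitionable_singletons:
  assumes "loopfree_digraph G" "finite (verts G)"
  shows "\<exists>k. partitionable k (\<lambda>S. acyclic_digraph (G \<restriction> S)) (verts G)"
proof -
  obtain h where h: "bij_betw h {0..<card (verts G)} (verts G)"
    using ex_bij_betw_nat_finite[OF assms(2)] by blast
  have "acyclic_digraph (G \<restriction> {v})" for v
  proof -
    have "p = []" if "pre_digraph.awalk (G \<restriction> {v}) u p u" for u p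
      using that loopfree_digraph.no_loops[OF assms(1)]
      by (cases p) (fastforce simp: pre_digraph.awalk_def)+
    then show ?thesis
      unfolding acyclic_digraph_def pre_digraph.cycle_def by blast
  qed
  moreover have "(\<Union>i<card (verts G). {h i}) = verts G"
    using h by (auto simp: bij_betw_def atLeast0LessThan)
  moreover have "disjoint_family_on (\<lambda>i. {h i}) {..<card (verts G)}"
    using h by (auto simp: bij_betw_def disjoint_family_on_def inj_on_def atLeast0LessThan)
  ultimately show ?thesis unfolding partitionable_def by blast
qed

text \<open>At most \<open>k\<close> acyclic classes, each of a size \<open>m\<close> with
  \<open>k * m < card (verts G)\<close>, are too small to cover \<open>verts G\<close>.\<close>

lemma dichromatic_number_gt:
  assumes "loopfree_digraph G" "finite (verts G)"
    and "\<And>S. S \<subseteq> verts G \<Longrightarrow> acyclic_digraph (G \<restriction> S) \<Longrightarrow> k * card S < card (verts G)"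
  shows "k < dichromatic_number G"
proof (rule ccontr)
  let ?c = "dichromatic_number G"
  assume "\<not> k < ?c"
  have "partitionable ?c (\<lambda>S. acyclic_digraph (G \<restriction> S)) (verts G)"
    unfolding dichromatic_number_def
    using LeastI_ex[OF partitionable_singletons[OF assms(1,2)]] .
  then obtain S where S: "(\<Union>i<?c. S i) = verts G" "\<forall>i<?c. acyclic_digraph (G \<restriction> S i)"
    unfolding partitionable_def by blast
  have lt: "k * card (S i) < card (verts G)" if "i < ?c" for i
    using assms(3)[of "S i"] S that by blast
  \<comment> \<open>The empty class shows that \<open>G\<close> has a vertex, so there is at least
    one class, as the strict sum below requires.\<close>
  have "acyclic_digraph (G \<restriction> {})"
    by (auto simp: acyclic_digraph_def pre_digraph.cycle_def pre_digraph.awalk_def)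
  then have "verts G \<noteq> {}" using assms(3)[of "{}"] by auto
  then have "?c > 0" using S(1) by (cases ?c) auto
  have "k * card (verts G) \<le> k * (\<Sum>i<?c. card (S i))"
    using S(1) card_UN_le[of "{..<?c}" S] by (simp add: mult_le_mono2)
  also have "\<dots> = (\<Sum>i<?c. k * card (S i))" by (simp add: sum_distrib_left)
  also have "\<dots> < (\<Sum>i<?c. card (verts G))"
    using lt \<open>?c > 0\<close> by (intro sum_strict_mono) auto
  also have "\<dots> \<le> k * card (verts G)" using \<open>\<not> k < ?c\<close> by simp
  finally show False by simp
qed

theorem theorem2p5:
  shows "\<exists>F :: nat \<Rightarrow> nat pair_pre_digraph.
    (\<forall>n\<ge>1. oriented_digraph (with_proj (F n))) \<and>
    filterlim (\<lambda>n. dichromatic_number (with_proj (F n))) at_top sequentially \<and>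
    (\<forall>n\<ge>1. \<forall>v \<in> verts (with_proj (F n)).
       partitionable 3 (\<lambda>S. tournament (with_proj (F n) \<restriction> S))
         (neighbourhood (with_proj (F n)) v)) \<and>
    (\<forall>n\<ge>1. \<not> contains_digraph (with_proj (F n)) (with_proj in_triangle))"
proof -
  \<comment> \<open>The side length that the counting argument asks for with \<open>k = n\<close>;
    it makes the dichromatic number of the digraph with index \<open>n\<close> exceed
    \<open>n\<close>.\<close>
  define N :: "nat \<Rightarrow> nat" where "N n = 2 ^ (12 * n + 1)" for n
  have "\<forall>n. \<exists>w. \<forall>S \<subseteq> {..<(N n)\<^sup>2}.
      acyclic_digraph (with_proj (grid_digraph (N n) w) \<restriction> S) \<longrightarrow> n * card S < (N n)\<^sup>2"
    using exists_labels_no_large_acyclic N_def by blast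
  then obtain w where w: "\<And>n S. S \<subseteq> {..<(N n)\<^sup>2} \<Longrightarrow>
      acyclic_digraph (with_proj (grid_digraph (N n) (w n)) \<restriction> S) \<Longrightarrow> n * card S < (N n)\<^sup>2"
    by metis
  define F where "F n = grid_digraph (N n) (w n)" for n
  have verts: "pverts (F n) = {..<(N n)\<^sup>2}" for n by (simp add: F_def grid_digraph_def)
  have ori: "oriented_digraph (with_proj (F n))" for n
    unfolding F_def by (rule oriented_digraph_grid)
  have "n < dichromatic_number (with_proj (F n))" for n
  proof (rule dichromatic_number_gt)
    interpret oriented_digraph "with_proj (F n)" by (rule ori)
    show "loopfree_digraph (with_proj (F n))" by unfold_locales
    show "finite (verts (with_proj (F n)))" by (rule finite_verts)
    show "n * card S < card (verts (with_proj (F n)))"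
      if "S \<subseteq> verts (with_proj (F n))" "acyclic_digraph (with_proj (F n) \<restriction> S)" for S
      using w[of S n] that verts[of n] by (simp add: F_def)
  qed
  then have "filterlim (\<lambda>n. dichromatic_number (with_proj (F n))) at_top sequentially"
    by (intro filterlim_at_top_mono[OF filterlim_ident]) (auto intro!: always_eventually less_imp_le)
  moreover have "\<forall>v \<in> verts (with_proj (F n)).
       partitionable 3 (\<lambda>S. tournament (with_proj (F n) \<restriction> S))
         (neighbourhood (with_proj (F n)) v)" for n
    using partitionable_neighbourhood_grid verts by (auto simp: F_def)
  moreover have "\<not> contains_digraph (with_proj (F n)) (with_proj in_triangle)" for n
    unfolding F_def by (rule grid_digraph_no_in_triangle)
  ultimately show ?thesis using ori by blast
qed

end
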